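(* Let $S$ be a recurrent specular set on the finite alphabet $A$. For any nonempty $x\in S$, the set $\mathcal{R}_S(x)$ of right return words to $x$ in $S$ has $\mathrm{Card}(A)-1$ elements.
   Context: Words are over a finite alphabet $A$; $\varepsilon$ is the empty word. A set $S$ of words on $A$ is factorial if it contains $A$ and all the factors of its elements. For $w\in S$ let $L(w)=\{a\in A\mid aw\in S\}$, $R(w)=\{a\in A\mid wa\in S\}$, $B(w)=\{(a,b)\in A\times A\mid awb\in S\}$. A factorial set $S$ is biextendable if $B(w)\neq\emptyset$ for all $w\in S$. The extension graph $\mathcal{E}(w)$ is the undirected graph whose vertex set is the disjoint union of $L(w)$ and $R(w)$ and whose edges are the pairs in $B(w)$. A biextendable set $S$ is a tree set of characteristic $c$ if $\mathcal{E}(w)$ is a tree for every nonempty $w\in S$ and $\mathcal{E}(\varepsilon)$ is a disjoint union of $c$ trees. Let $\theta$ be an involution on $A$ (possibly with fixed points) and let $G_\theta$ be the group generated by $A$ with relations $a\theta(a)=1$, $a\in A$ (so $a^{-1}=\theta(a)$). A word is reduced if it has no factor $a\theta(a)$ with $a\in A$; the inverse of a reduced word $a_1\cdots a_n$ is the reduced word $\theta(a_n)\cdots\theta(a_1)$. A laminary set on $A$ relative to $\theta$ is a biextendable set of reduced words closed under taking inverses. A specular set is a laminary set which is a tree set of characteristic $2$. A set $S\ne\{\varepsilon\}$ is recurrent if it is factorial and for all $u,w\in S$ there is $v\in S$ with $uvw\in S$. A complete return word to $x$ is a word of $S$ having $x$ as a proper prefix and as a proper suffix, and such that $x$ is not an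 internal factor of it ($v$ is an internal factor of $y$ if $y=uvw$ with $u,w$ nonempty). A right return word to $x$ in $S$ is a word $w$ such that $xw$ is a complete return word to $x$. *)

theory Defs
  imports Main "HOL-Library.Sublist" "HOL-Library.Disjoint_Sets"
begin

text \<open>
  A graph is given by a vertex set \<open>V\<close> and a set \<open>E\<close> of edges, each edge being the set of its
  two end points.
\<close>

definition graph_connected :: "'v set \<Rightarrow> 'v set set \<Rightarrow> bool" where
  "graph_connected V E \<longleftrightarrow>
     (\<forall>u\<in>V. \<forall>v\<in>V. (u, v) \<in> {(p, q). p \<in> V \<and> q \<in> V \<and> {p, q} \<in> E}\<^sup>*)"

text \<open>Length at least 3 excludes running back and forth along a single edge.\<close>

definition graph_cycle :: "'v set \<Rightarrow> 'v set set \<Rightarrow> 'v list \<Rightarrow> bool" where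
  "graph_cycle V E vs \<longleftrightarrow>
     3 \<le> length vs \<and> distinct vs \<and> set vs \<subseteq> V \<and>
     (\<forall>i. Suc i < length vs \<longrightarrow> {vs ! i, vs ! Suc i} \<in> E) \<and> {last vs, hd vs} \<in> E"

definition is_tree :: "'v set \<Rightarrow> 'v set set \<Rightarrow> bool" where
  "is_tree V E \<longleftrightarrow> V \<noteq> {} \<and> graph_connected V E \<and> (\<nexists>vs. graph_cycle V E vs)"

definition is_disjoint_union_of_trees :: "nat \<Rightarrow> 'v set \<Rightarrow> 'v set set \<Rightarrow> bool" where
  "is_disjoint_union_of_trees c V E \<longleftrightarrow>
     (\<exists>P. partition_on V P \<and> finite P \<and> card P = c \<and>
          (\<forall>e\<in>E. \<exists>W\<in>P. e \<subseteq> W) \<and>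
          (\<forall>W\<in>P. is_tree W {e \<in> E. e \<subseteq> W}))"

definition factorial_set :: "'a set \<Rightarrow> 'a list set \<Rightarrow> bool" where
  "factorial_set A S \<longleftrightarrow>
     S \<subseteq> lists A \<and> (\<forall>a\<in>A. [a] \<in> S) \<and> (\<forall>w\<in>S. \<forall>v. sublist v w \<longrightarrow> v \<in> S)"

definition left_ext :: "'a set \<Rightarrow> 'a list set \<Rightarrow> 'a list \<Rightarrow> 'a set" where
  "left_ext A S w = {a \<in> A. [a] @ w \<in> S}"

definition right_ext :: "'a set \<Rightarrow> 'a list set \<Rightarrow> 'a list \<Rightarrow> 'a set" where
  "right_ext A S w = {a \<in> A. w @ [a] \<in> S}"

definition bi_ext :: "'a set \<Rightarrow> 'a list set \<Rightarrow> 'a list \<Rightarrow> ('a \<times> 'a) set" where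
  "bi_ext A S w = {(a, b) \<in> A \<times> A. [a] @ w @ [b] \<in> S}"

definition biextendable :: "'a set \<Rightarrow> 'a list set \<Rightarrow> bool" where
  "biextendable A S \<longleftrightarrow> factorial_set A S \<and> (\<forall>w\<in>S. bi_ext A S w \<noteq> {})"

definition ext_graph_verts :: "'a set \<Rightarrow> 'a list set \<Rightarrow> 'a list \<Rightarrow> ('a + 'a) set" where
  "ext_graph_verts A S w = left_ext A S w <+> right_ext A S w"

definition ext_graph_edges :: "'a set \<Rightarrow> 'a list set \<Rightarrow> 'a list \<Rightarrow> ('a + 'a) set set" where
  "ext_graph_edges A S w = {{Inl a, Inr b} | a b. (a, b) \<in> bi_ext A S w}"

definition tree_set :: "nat \<Rightarrow> 'a set \<Rightarrow> 'a list set \<Rightarrow> bool" where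
  "tree_set c A S \<longleftrightarrow>
     biextendable A S \<and>
     (\<forall>w\<in>S. w \<noteq> [] \<longrightarrow> is_tree (ext_graph_verts A S w) (ext_graph_edges A S w)) \<and>
     is_disjoint_union_of_trees c (ext_graph_verts A S []) (ext_graph_edges A S [])"

definition involution_on :: "'a set \<Rightarrow> ('a \<Rightarrow> 'a) \<Rightarrow> bool" where
  "involution_on A \<theta> \<longleftrightarrow> (\<forall>a\<in>A. \<theta> a \<in> A \<and> \<theta> (\<theta> a) = a)"

definition reduced_word :: "'a set \<Rightarrow> ('a \<Rightarrow> 'a) \<Rightarrow> 'a list \<Rightarrow> bool" where
  "reduced_word A \<theta> w \<longleftrightarrow> w \<in> lists A \<and> (\<forall>a\<in>A. \<not> sublist [a, \<theta> a] w)"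

definition inverse_word :: "('a \<Rightarrow> 'a) \<Rightarrow> 'a list \<Rightarrow> 'a list" where
  "inverse_word \<theta> w = rev (map \<theta> w)"

definition laminary_set :: "'a set \<Rightarrow> ('a \<Rightarrow> 'a) \<Rightarrow> 'a list set \<Rightarrow> bool" where
  "laminary_set A \<theta> S \<longleftrightarrow>
     biextendable A S \<and> (\<forall>w\<in>S. reduced_word A \<theta> w) \<and> (\<forall>w\<in>S. inverse_word \<theta> w \<in> S)"

definition specular_set :: "'a set \<Rightarrow> ('a \<Rightarrow> 'a) \<Rightarrow> 'a list set \<Rightarrow> bool" where
  "specular_set A \<theta> S \<longleftrightarrow> laminary_set A \<theta> S \<and> tree_set 2 A S"

definition recurrent_set :: "'a set \<Rightarrow> 'a list set \<Rightarrow> bool" where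
  "recurrent_set A S \<longleftrightarrow>
     S \<noteq> {[]} \<and> factorial_set A S \<and> (\<forall>u\<in>S. \<forall>w\<in>S. \<exists>v\<in>S. u @ v @ w \<in> S)"

definition internal_factor :: "'a list \<Rightarrow> 'a list \<Rightarrow> bool" where
  "internal_factor v y \<longleftrightarrow> (\<exists>u w. u \<noteq> [] \<and> w \<noteq> [] \<and> y = u @ v @ w)"

definition complete_return_word :: "'a list set \<Rightarrow> 'a list \<Rightarrow> 'a list \<Rightarrow> bool" where
  "complete_return_word S x y \<longleftrightarrow>
     y \<in> S \<and> strict_prefix x y \<and> strict_suffix x y \<and> \<not> internal_factor x y"

definition right_return_words :: "'a list set \<Rightarrow> 'a list \<Rightarrow> 'a list set" where
  "right_return_words S x = {w. complete_return_word S x (x @ w)}"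

end

theory Submission imports Defs
begin

text \<open>
  Put \<open>\<rho> w = card (R w) - 1\<close>. Counting the edges of the extension graphs shows that \<open>\<rho>\<close> is
  additive under left extension of nonempty words and that the letters have total weight
  \<open>card A - 2\<close>; hence a finite suffix code of nonempty words in \<open>S\<close> has weight at most
  \<open>card A - 2\<close>, with equality if every long word of \<open>S\<close> has a suffix in it. The words of \<open>S\<close> in
  which \<open>x\<close> occurs exactly once, namely as a prefix, form a suffix code \<open>P\<close>. They are also the
  inner nodes of a tree with root \<open>x\<close> whose leaves are the complete return words to \<open>x\<close>,
  so the number of leaves is \<open>1 + (\<Sum>p\<in>P. \<rho> p)\<close>. The weight bound makes the set of leaves finite,
  recurrence then makes \<open>P\<close> finite and unavoidable, and the weight of \<open>P\<close> is \<open>card A - 2\<close>.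
\<close>

section \<open>Edges of finite trees\<close>

lemma graph_cycle_mono:
  "graph_cycle V E vs \<Longrightarrow> V \<subseteq> V' \<Longrightarrow> E \<subseteq> E' \<Longrightarrow> graph_cycle V' E' vs"
  unfolding graph_cycle_def by blast

text \<open>A walk between other vertices can enter and leave \<open>l\<close> only through
  \<open>n\<close>, so its visits to \<open>l\<close> can be cut out.\<close>

lemma graph_connected_remove_leaf:
  assumes conn: "graph_connected V E"
    and leaf: "\<And>v. v \<in> V \<Longrightarrow> {l, v} \<in> E \<Longrightarrow> v = n"
    and "n \<noteq> l"
  shows "graph_connected (V - {l}) {e \<in> E. l \<notin> e}"
proof -
  let ?R = "{(p, q). p \<in> V \<and> q \<in> V \<and> {p, q} \<in> E}"
  let ?R' = "{(p, q). p \<in> V - {l} \<and> q \<in> V - {l} \<and> {p, q} \<in> {e \<in> E. l \<notin> e}}"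
  \<comment> \<open>While the walk stands at \<open>l\<close>, its shortened copy waits at
    \<open>n\<close>.\<close>
  have *: "(u, if w = l then n else w) \<in> ?R'\<^sup>*" if "(u, w) \<in> ?R\<^sup>*" "u \<noteq> l" for u w
    using that(1)
  proof (induction rule: rtrancl_induct)
    case base
    then show ?case using that(2) by simp
  next
    case (step y z)
    then have yz: "y \<in> V" "z \<in> V" "{y, z} \<in> E" by auto
    consider "y = l" | "z = l" "y \<noteq> l" | "y \<noteq> l" "z \<noteq> l" by blast
    then show ?case
    proof cases
      case 1
      then show ?thesis using step.IH leaf[of z] yz by auto
    next
      case 2
      then show ?thesis using step.IH leaf[of y] yz by (simp add: insert_commute)
    next
      case 3
      then have "(y, z) \<in> ?R'" using yz by auto
      then show ?thesis using step.IH 3 by (simp add: rtrancl.rtrancl_into_rtrancl)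
    qed
  qed
  show ?thesis
    unfolding graph_connected_def
  proof (intro ballI)
    fix u v assume "u \<in> V - {l}" "v \<in> V - {l}"
    then show "(u, v) \<in> ?R'\<^sup>*"
      using *[of u v] conn unfolding graph_connected_def by auto
  qed
qed

text \<open>An end point of a longest path is a leaf.\<close>

lemma tree_leaf_exists:
  assumes "finite V" "is_tree V E" "card V \<noteq> 1"
  obtains l n where "l \<in> V" "n \<in> V" "{l, n} \<in> E" "\<And>v. v \<in> V \<Longrightarrow> v \<noteq> l \<Longrightarrow> {l, v} \<in> E \<Longrightarrow> v = n"
    "n \<noteq> l"
proof -
  define path where "path vs \<longleftrightarrow> vs \<noteq> [] \<and> distinct vs \<and> set vs \<subseteq> V \<and>
    (\<forall>i. Suc i < length vs \<longrightarrow> {vs ! i, vs ! Suc i} \<in> E)" for vs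
  have conn: "graph_connected V E" and acyclic: "\<And>vs. \<not> graph_cycle V E vs" and ne: "V \<noteq> {}"
    using assms(2) unfolding is_tree_def by auto
  obtain v0 where v0: "v0 \<in> V" using ne by blast
  have "path [v0]" using v0 unfolding path_def by simp
  moreover have "length vs \<le> card V" if "path vs" for vs
    using that assms(1) unfolding path_def by (metis card_mono distinct_card)
  ultimately obtain vs where vs: "path vs" and max: "\<And>us. path us \<Longrightarrow> length us \<le> length vs"
    using ex_has_greatest_nat[of path "[v0]" length "card V + 1"] by fastforce
  obtain l ws where lws: "vs = l # ws" using vs unfolding path_def by (cases vs) auto
  have lV: "l \<in> V" using vs lws unfolding path_def by auto
  obtain v1 where "v1 \<in> V" "v1 \<noteq> l"
  proof -
    have "V \<noteq> {l}" using assms(3) by auto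
    then show thesis using lV that by blast
  qed
  \<comment> \<open>Otherwise \<open>v\<close> could be put in front of \<open>vs\<close>, against
    the choice of a longest path.\<close>
  have nbr: "\<exists>i. i < length ws \<and> v = ws ! i" if "v \<in> V" "{l, v} \<in> E" "v \<noteq> l" for v
  proof (rule ccontr)
    assume "\<not> ?thesis"
    then have "v \<notin> set vs" using that(3) lws by (auto simp: in_set_conv_nth)
    then have "path (v # vs)"
      using vs that unfolding path_def lws
      by (auto simp: nth_Cons insert_commute split: nat.splits)
    from max[OF this] show False by simp
  qed
  \<comment> \<open>A neighbour further along would close a cycle with the segment of the path up to
    it; \<open>i \<noteq> 0\<close> gives this cycle at least three vertices.\<close>
  have first: "v = ws ! 0" if v: "v \<in> V" "{l, v} \<in> E" "v \<noteq> l" for v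
  proof (rule ccontr)
    assume neq: "v \<noteq> ws ! 0"
    obtain i where i: "i < length ws" "v = ws ! i" using nbr[OF v] by blast
    then have "i \<noteq> 0" using neq by (cases i) auto
    let ?c = "take (Suc (Suc i)) vs"
    have "last ?c = v"
      using i lws by (auto simp: last_conv_nth)
    moreover have "hd ?c = l" using lws by simp
    moreover have "length ?c = Suc (Suc i)" using i lws by simp
    ultimately have "graph_cycle V E ?c"
      using vs v(2) \<open>i \<noteq> 0\<close> unfolding graph_cycle_def path_def
      by (auto simp: insert_commute dest: in_set_takeD)
    then show False using acyclic by blast
  qed
  \<comment> \<open>With no second vertex on the path, \<open>l\<close> has no neighbour but
    possibly itself, and \<open>v1\<close> cannot be reached.\<close>
  have loop: "ws \<noteq> []"
  proof
    assume ws: "ws = []"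
    let ?R = "{(p, q). p \<in> V \<and> q \<in> V \<and> {p, q} \<in> E}"
    have "w = l" if "(l, w) \<in> ?R\<^sup>*" for w
      using that
    proof (induction rule: rtrancl_induct)
      case (step y z)
      then show ?case using nbr[of z] ws by auto
    qed simp
    then show False
      using conn lV \<open>v1 \<in> V\<close> \<open>v1 \<noteq> l\<close> unfolding graph_connected_def by blast
  qed
  have "ws ! 0 \<in> V" "{l, ws ! 0} \<in> E" "ws ! 0 \<noteq> l"
    using vs loop unfolding path_def lws by (auto dest!: spec[of _ 0] simp: neq_Nil_conv)
  then show thesis
    using that[of l "ws ! 0"] lV first by blast
qed

text \<open>Induction on the number of vertices: a leaf is removed together with the one edge at it.
  The last hypothesis excludes edges leaving \<open>V\<close> and loops, which
  \<open>graph_cycle\<close> does not see.\<close>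

lemma card_edges_tree:
  assumes "finite V" "is_tree V E"
    and "\<And>e. e \<in> E \<Longrightarrow> \<exists>u\<in>V. \<exists>v\<in>V. u \<noteq> v \<and> e = {u, v}"
  shows "card V = card E + 1"
  using assms
proof (induction "card V" arbitrary: V E rule: less_induct)
  case less
  note edges = less.prems(3)
  show ?case
  proof (cases "card V = 1")
    case True
    then obtain v where "V = {v}" by (auto simp: card_1_singleton_iff)
    then have "E = {}" using edges by fastforce
    then show ?thesis using True by simp
  next
    case False
    obtain l n where l: "l \<in> V" "n \<in> V" "{l, n} \<in> E" "n \<noteq> l"
      and leaf: "\<And>v. v \<in> V \<Longrightarrow> v \<noteq> l \<Longrightarrow> {l, v} \<in> E \<Longrightarrow> v = n"
      using tree_leaf_exists[OF less.prems(1,2) False] by metis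
    have "{l, l} \<notin> E" using edges[of "{l, l}"] by auto
    then have leaf': "v = n" if "v \<in> V" "{l, v} \<in> E" for v
      using leaf that by blast
    let ?V = "V - {l}" and ?E = "{e \<in> E. l \<notin> e}"
    have "E \<subseteq> Pow V" using edges by blast
    then have "finite E" using less.prems(1) by (meson finite_Pow_iff finite_subset)
    have "e = {l, n}" if e: "e \<in> E" "l \<in> e" for e
    proof -
      obtain v where "v \<in> V" "e = {l, v}"
        using edges[OF e(1)] e(2) by (metis insertE insert_commute singletonD)
      then show ?thesis using leaf' e(1) by blast
    qed
    then have E: "E = insert {l, n} ?E" using l(3) by blast
    have "card E = Suc (card ?E)"
      by (subst E, subst card_insert_disjoint) (use \<open>finite E\<close> in auto)
    moreover have "card ?V < card V" using l(1) less.prems(1) by (meson card_Diff1_less)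
    moreover have "is_tree ?V ?E"
      using less.prems(2) l graph_connected_remove_leaf[OF _ leaf' l(4)]
        graph_cycle_mono[of ?V ?E _ V E]
      unfolding is_tree_def by auto
    moreover have "\<exists>u\<in>?V. \<exists>v\<in>?V. u \<noteq> v \<and> e = {u, v}" if e: "e \<in> ?E" for e
    proof -
      obtain u v where "u \<in> V" "v \<in> V" "u \<noteq> v" "e = {u, v}"
        using edges[of e] e by auto
      then show ?thesis using e by (intro bexI[of _ u] bexI[of _ v]) auto
    qed
    ultimately have "card ?V = card ?E + 1"
      using less.hyps[of ?V ?E] less.prems(1) by simp
    then show ?thesis
      using \<open>card E = Suc (card ?E)\<close> l(1) less.prems(1)
      by (metis Suc_eq_plus1 card_Suc_Diff1)
  qed
qed

text \<open>The formula for one tree is summed over the parts, each of which contributes 1.\<close>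

lemma card_edges_disjoint_union_of_trees:
  assumes "finite V" "is_disjoint_union_of_trees c V E"
    and edges: "\<And>e. e \<in> E \<Longrightarrow> \<exists>u v. u \<noteq> v \<and> e = {u, v}"
  shows "card V = card E + c"
proof -
  obtain P where P: "partition_on V P" "finite P" "card P = c"
    and sub: "\<And>e. e \<in> E \<Longrightarrow> \<exists>W\<in>P. e \<subseteq> W"
    and tree: "\<And>W. W \<in> P \<Longrightarrow> is_tree W {e \<in> E. e \<subseteq> W}"
    using assms(2) unfolding is_disjoint_union_of_trees_def by auto
  have V: "V = \<Union>P" and disj: "disjoint P" using P(1) unfolding partition_on_def by auto
  have fin: "finite W" if "W \<in> P" for W
    using that assms(1) V by (meson Union_upper finite_subset)
  have "E \<subseteq> Pow V" using sub V by blast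
  then have "finite E" using assms(1) by (meson finite_Pow_iff finite_subset)
  have "card V = (\<Sum>W\<in>P. card W)"
    unfolding V using disj fin
    by (intro card_Union_disjoint) (auto simp: disjoint_def pairwise_def disjnt_def)
  also have "\<dots> = (\<Sum>W\<in>P. card {e \<in> E. e \<subseteq> W} + 1)"
  proof (rule sum.cong[OF refl])
    fix W assume W: "W \<in> P"
    show "card W = card {e \<in> E. e \<subseteq> W} + 1"
    proof (rule card_edges_tree[OF fin[OF W] tree[OF W]])
      fix e assume e: "e \<in> {e \<in> E. e \<subseteq> W}"
      then obtain u v where "u \<noteq> v" "e = {u, v}" using edges[of e] by auto
      then show "\<exists>u\<in>W. \<exists>v\<in>W. u \<noteq> v \<and> e = {u, v}"
        using e by (intro bexI[of _ u] bexI[of _ v]) auto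
    qed
  qed
  also have "\<dots> = (\<Sum>W\<in>P. card {e \<in> E. e \<subseteq> W}) + c"
    by (subst sum.distrib) (use P(3) in simp)
  also have "(\<Sum>W\<in>P. card {e \<in> E. e \<subseteq> W}) = card (\<Union>W\<in>P. {e \<in> E. e \<subseteq> W})"
  proof (intro card_UN_disjoint[symmetric] P(2) ballI impI)
    fix W W' assume "W \<in> P" "W' \<in> P" "W \<noteq> W'"
    then have "W \<inter> W' = {}" using disj unfolding disjoint_def by blast
    \<comment> \<open>An empty edge would lie in every part and be counted several times.\<close>
    moreover have "{} \<notin> E" using edges[of "{}"] by auto
    ultimately show "{e \<in> E. e \<subseteq> W} \<inter> {e \<in> E. e \<subseteq> W'} = {}"
      by (auto simp: disjoint_iff) (metis ex_in_conv subset_iff)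
  qed (use \<open>finite E\<close> in auto)
  also have "(\<Union>W\<in>P. {e \<in> E. e \<subseteq> W}) = E" using sub by blast
  finally show ?thesis .
qed

section \<open>Neutral sets\<close>

lemma card_ext_graph_edges: "card (ext_graph_edges A S w) = card (bi_ext A S w)"
proof -
  have "ext_graph_edges A S w = (\<lambda>(a, b). {Inl a, Inr b}) ` bi_ext A S w"
    unfolding ext_graph_edges_def by auto
  moreover have "inj_on (\<lambda>(a, b). {Inl a, Inr b}) (bi_ext A S w)"
    by (auto simp: inj_on_def doubleton_eq_iff)
  ultimately show ?thesis by (simp add: card_image)
qed

lemma factorial_setD: "factorial_set A S \<Longrightarrow> u @ v @ w \<in> S \<Longrightarrow> v \<in> S"
  unfolding factorial_set_def by (metis sublist_appendI)

text \<open>Of the tree condition only the edge counts are retained. In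
  \<open>characteristic\<close>, \<open>2 * card A\<close> is the number of vertices of the
  extension graph of the empty word.\<close>

locale neutral_set =
  fixes A :: "'a set" and S :: "'a list set" and c :: nat
  assumes finite_alphabet: "finite A"
    and biext: "biextendable A S"
    and neutral: "w \<in> S \<Longrightarrow> w \<noteq> [] \<Longrightarrow>
      card (left_ext A S w) + card (right_ext A S w) = card (bi_ext A S w) + 1"
    and characteristic: "2 * card A = card (bi_ext A S []) + c"

lemma tree_set_imp_neutral_set:
  assumes "finite A" "tree_set c A S"
  shows "neutral_set A S c"
proof
  show "finite A" by fact
  show "biextendable A S" using assms(2) unfolding tree_set_def by blast
  then have fact: "factorial_set A S" unfolding biextendable_def by blast
  have fin: "finite (left_ext A S w)" "finite (right_ext A S w)" for w
    using assms(1) unfolding left_ext_def right_ext_def by auto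
  have finV: "finite (ext_graph_verts A S w)" for w
    unfolding ext_graph_verts_def using fin by simp
  have cardV: "card (ext_graph_verts A S w) = card (left_ext A S w) + card (right_ext A S w)" for w
    unfolding ext_graph_verts_def using fin by (simp add: card_Plus)
  show "card (left_ext A S w) + card (right_ext A S w) = card (bi_ext A S w) + 1"
    if "w \<in> S" "w \<noteq> []" for w
    unfolding cardV[symmetric] card_ext_graph_edges[symmetric]
  proof (rule card_edges_tree[OF finV])
    show "is_tree (ext_graph_verts A S w) (ext_graph_edges A S w)"
      using assms(2) that unfolding tree_set_def by blast
    fix e assume "e \<in> ext_graph_edges A S w"
    then obtain a b where e: "e = {Inl a, Inr b}" "a \<in> A" "b \<in> A" "[a] @ w @ [b] \<in> S"
      unfolding ext_graph_edges_def bi_ext_def by auto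
    have "[a] @ w \<in> S" "w @ [b] \<in> S"
      using factorial_setD[OF fact, of "[]" "[a] @ w" "[b]"]
        factorial_setD[OF fact, of "[a]" "w @ [b]" "[]"] e(4) by auto
    then show "\<exists>u\<in>ext_graph_verts A S w. \<exists>v\<in>ext_graph_verts A S w. u \<noteq> v \<and> e = {u, v}"
      using e unfolding ext_graph_verts_def left_ext_def right_ext_def
      by (intro bexI[of _ "Inl a"] bexI[of _ "Inr b"]) auto
  qed
  have "card (ext_graph_verts A S []) = card (ext_graph_edges A S []) + c"
  proof (rule card_edges_disjoint_union_of_trees[OF finV])
    show "is_disjoint_union_of_trees c (ext_graph_verts A S []) (ext_graph_edges A S [])"
      using assms(2) unfolding tree_set_def by blast
    show "\<exists>u v. u \<noteq> v \<and> e = {u, v}" if "e \<in> ext_graph_edges A S []" for e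
      using that unfolding ext_graph_edges_def by blast
  qed
  moreover have "left_ext A S [] = A" "right_ext A S [] = A"
    using fact unfolding left_ext_def right_ext_def factorial_set_def by auto
  ultimately show "2 * card A = card (bi_ext A S []) + c"
    by (simp add: cardV card_ext_graph_edges)
qed

context neutral_set
begin

lemma factor_closed: "u @ v @ w \<in> S \<Longrightarrow> v \<in> S"
  using biext factorial_setD unfolding biextendable_def by blast

lemma prefix_closed: "u @ v \<in> S \<Longrightarrow> u \<in> S"
  using factor_closed[of "[]" u v] by simp

lemma suffix_closed: "u @ v \<in> S \<Longrightarrow> v \<in> S"
  using factor_closed[of u v "[]"] by simp

lemma in_lists: "w \<in> S \<Longrightarrow> set w \<subseteq> A"
  using biext unfolding biextendable_def factorial_set_def by auto

lemma letter_in: "a \<in> A \<Longrightarrow> [a] \<in> S"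
  using biext unfolding biextendable_def factorial_set_def by auto

lemma finite_length: "finite {w \<in> S. length w = n \<and> Q w}"
  by (rule finite_subset[OF _ finite_lists_length_eq[OF finite_alphabet, of n]]) (use in_lists in auto)

lemma finite_right_ext: "finite (right_ext A S w)"
  and finite_left_ext: "finite (left_ext A S w)"
  using finite_alphabet unfolding left_ext_def right_ext_def by auto

section \<open>Weights of words and of suffix codes\<close>

definition weight :: "'a list \<Rightarrow> int" where
  "weight w = int (card (right_ext A S w)) - 1"

lemma weight_nonneg:
  assumes "w \<in> S" shows "0 \<le> weight w"
proof -
  obtain a b where "b \<in> A" "a # w @ [b] \<in> S"
    using biext assms unfolding biextendable_def bi_ext_def by auto
  then have "b \<in> right_ext A S w"
    using suffix_closed[of "[a]"] unfolding right_ext_def by simp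
  then have "card (right_ext A S w) \<noteq> 0" using finite_right_ext by auto
  then show ?thesis unfolding weight_def by simp
qed

lemma card_bi_ext: "card (bi_ext A S w) = (\<Sum>a\<in>left_ext A S w. card (right_ext A S (a # w)))"
proof -
  have "bi_ext A S w = Sigma (left_ext A S w) (\<lambda>a. right_ext A S (a # w))"
    using prefix_closed[of "_ # w" "[_]"] unfolding bi_ext_def left_ext_def right_ext_def by auto
  then show ?thesis using finite_left_ext finite_right_ext by simp
qed

text \<open>Serves both the nonempty words, through \<open>neutral\<close>, and the empty word,
  through \<open>characteristic\<close>.\<close>

lemma weight_left_ext_sum:
  "(\<Sum>a\<in>left_ext A S w. weight (a # w)) = int (card (bi_ext A S w)) - int (card (left_ext A S w))"
  unfolding card_bi_ext weight_def by (simp add: sum_subtractf)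

text \<open>Additivity of the weight: neutrality turns
  \<open>card (bi_ext A S w) - card (left_ext A S w)\<close> into
  \<open>card (right_ext A S w) - 1\<close>.\<close>

lemma weight_left_ext:
  assumes "w \<in> S" "w \<noteq> []"
  shows "(\<Sum>a\<in>left_ext A S w. weight (a # w)) = weight w"
  using neutral[OF assms] weight_left_ext_sum[of w] by (simp add: weight_def)

text \<open>As \<open>p\<close> has length at most \<open>n\<close>, deleting the first letter of a
  word of length \<open>Suc n\<close> keeps the suffix \<open>p\<close>. The case
  \<open>p = []\<close> covers all words of a given length.\<close>

lemma weight_suffix_Suc:
  assumes "length p \<le> n"
  shows "(\<Sum>w | w \<in> S \<and> length w = Suc n \<and> suffix p w. weight w) =
    (\<Sum>w | w \<in> S \<and> length w = n \<and> suffix p w. \<Sum>a\<in>left_ext A S w. weight (a # w))"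
proof -
  let ?T = "\<lambda>n. {w \<in> S. length w = n \<and> suffix p w}"
  have "bij_betw (\<lambda>(w, a). a # w) (Sigma (?T n) (left_ext A S)) (?T (Suc n))"
  proof (rule bij_betwI')
    fix y assume y: "y \<in> ?T (Suc n)"
    then obtain a w where aw: "y = a # w" by (cases y) auto
    then have "w \<in> S" "a \<in> A" using y suffix_closed[of "[a]" w] in_lists[of y] by auto
    moreover have "suffix p w" using y aw assms by (auto simp: suffix_Cons)
    ultimately have "(w, a) \<in> Sigma (?T n) (left_ext A S)"
      using y aw unfolding left_ext_def by auto
    then show "\<exists>z\<in>Sigma (?T n) (left_ext A S). y = (\<lambda>(w, a). a # w) z"
      using aw by (intro bexI[of _ "(w, a)"]) auto
  qed (auto simp: left_ext_def suffix_Cons)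
  then have "(\<Sum>w\<in>?T (Suc n). weight w) = (\<Sum>(w, a)\<in>Sigma (?T n) (left_ext A S). weight (a # w))"
    using sum.reindex_bij_betw[of "\<lambda>(w, a). a # w" _ _ weight] by (simp add: case_prod_unfold)
  also have "\<dots> = (\<Sum>w\<in>?T n. \<Sum>a\<in>left_ext A S w. weight (a # w))"
    using finite_length finite_left_ext by (subst sum.Sigma) auto
  finally show ?thesis .
qed

text \<open>Additivity is iterated: the weight of \<open>p\<close> is spread over its left
  extensions. As \<open>p\<close> is nonempty, neutrality applies at every length.\<close>

lemma weight_suffix:
  assumes "p \<in> S" "p \<noteq> []" "length p \<le> n"
  shows "(\<Sum>w | w \<in> S \<and> length w = n \<and> suffix p w. weight w) = weight p"
    using assms(3)
  proof (induction n rule: dec_induct)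
    case base
    have "{w. w \<in> S \<and> length w = length p \<and> suffix p w} = {p}"
      using assms(1) by (auto simp: suffix_def)
    then show ?case by simp
  next
    case (step n)
    show ?case
      unfolding weight_suffix_Suc[OF step.hyps(1)] step.IH[symmetric]
      using assms(2) by (intro sum.cong refl weight_left_ext) auto
  qed

  text \<open>The letters weigh \<open>card (bi_ext A S []) - card A\<close>, which is
    \<open>card A - c\<close> by \<open>characteristic\<close>; from there on additivity keeps the
    total constant.\<close>

  lemma weight_length:
    assumes "S \<noteq> {}"
    shows "(\<Sum>w | w \<in> S \<and> length w = Suc n. weight w) = int (card A) - int c"
  proof (induction n)
    case 0
    have "left_ext A S [] = A" using letter_in unfolding left_ext_def by auto
    moreover have "[] \<in> S" using assms prefix_closed[of "[]"] by auto
    then have "{w \<in> S. length w = 0 \<and> suffix [] w} = {[]}" by auto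
    ultimately show ?case
      using weight_suffix_Suc[of "[]" 0] weight_left_ext_sum[of "[]"] characteristic by simp
  next
    case (Suc n)
    have "(\<Sum>w | w \<in> S \<and> length w = Suc (Suc n). weight w) =
        (\<Sum>w | w \<in> S \<and> length w = Suc n. \<Sum>a\<in>left_ext A S w. weight (a # w))"
      using weight_suffix_Suc[of "[]" "Suc n"] by simp
    also have "\<dots> = (\<Sum>w | w \<in> S \<and> length w = Suc n. weight w)"
      by (intro sum.cong refl weight_left_ext) auto
    finally show ?case using Suc.IH by simp
  qed

  text \<open>Two suffixes of one word are comparable, so different members of a suffix code have
    disjoint sets of left extensions of length \<open>n\<close>.\<close>

  lemma weight_suffix_code:
    assumes "finite X" "X \<subseteq> S" "[] \<notin> X"
      and code: "\<And>p q. p \<in> X \<Longrightarrow> q \<in> X \<Longrightarrow> suffix p q \<Longrightarrow> p = q"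
      and len: "\<And>p. p \<in> X \<Longrightarrow> length p \<le> n"
    shows "(\<Sum>p\<in>X. weight p) = (\<Sum>w | w \<in> S \<and> length w = n \<and> (\<exists>p\<in>X. suffix p w). weight w)"
  proof -
    have "(\<Sum>p\<in>X. weight p) = (\<Sum>p\<in>X. \<Sum>w | w \<in> S \<and> length w = n \<and> suffix p w. weight w)"
      using assms(2,3) by (intro sum.cong refl weight_suffix[symmetric] len) auto
    also have "\<dots> = (\<Sum>w\<in>(\<Union>p\<in>X. {w \<in> S. length w = n \<and> suffix p w}). weight w)"
    proof (rule sum.UNION_disjoint[symmetric])
      show "\<forall>p\<in>X. finite {w \<in> S. length w = n \<and> suffix p w}"
        using finite_length by blast
      show "\<forall>p\<in>X. \<forall>q\<in>X. p \<noteq> q \<longrightarrow>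
          {w \<in> S. length w = n \<and> suffix p w} \<inter> {w \<in> S. length w = n \<and> suffix q w} = {}"
        using code suffix_same_cases by blast
    qed fact
    also have "(\<Union>p\<in>X. {w \<in> S. length w = n \<and> suffix p w}) =
        {w \<in> S. length w = n \<and> (\<exists>p\<in>X. suffix p w)}"
      by blast
    finally show ?thesis .
  qed

  lemma weight_suffix_code_le:
    assumes "finite X" "X \<subseteq> S" "[] \<notin> X" "S \<noteq> {}"
      and code: "\<And>p q. p \<in> X \<Longrightarrow> q \<in> X \<Longrightarrow> suffix p q \<Longrightarrow> p = q"
    shows "(\<Sum>p\<in>X. weight p) \<le> int (card A) - int c"
  proof -
    obtain n where n: "\<And>p. p \<in> X \<Longrightarrow> length p \<le> n"
      using assms(1) finite_nat_set_iff_bounded_le[of "length ` X"] by auto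
    \<comment> \<open>\<open>Suc n\<close> instead of \<open>n\<close>, since
      \<open>weight_length\<close> speaks of positive lengths only.\<close>
    have "(\<Sum>p\<in>X. weight p) = (\<Sum>w | w \<in> S \<and> length w = Suc n \<and> (\<exists>p\<in>X. suffix p w). weight w)"
      by (rule weight_suffix_code) (use assms n in \<open>auto intro: le_SucI\<close>)
    also have "\<dots> \<le> (\<Sum>w | w \<in> S \<and> length w = Suc n. weight w)"
      using finite_length[of "Suc n" "\<lambda>_. True"] weight_nonneg by (intro sum_mono2) auto
    finally show ?thesis using weight_length[OF assms(4)] by simp
  qed

  section \<open>Return words\<close>

  definition once_prefixed :: "'a list \<Rightarrow> 'a list set" where
    "once_prefixed x = {p \<in> S. prefix x p \<and> (\<forall>u v. p = u @ x @ v \<longrightarrow> u = [])}"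

  lemma once_prefixed_subset: "once_prefixed x \<subseteq> S"
    unfolding once_prefixed_def by blast

  lemma Nil_notin_once_prefixed: "x \<noteq> [] \<Longrightarrow> [] \<notin> once_prefixed x"
    unfolding once_prefixed_def by simp

  lemma once_prefixed_self: "x \<in> S \<Longrightarrow> x \<in> once_prefixed x"
    unfolding once_prefixed_def by (auto dest: arg_cong[of _ _ length])

  text \<open>The \<open>x\<close> that starts \<open>p\<close> is also an occurrence in
    \<open>q\<close>, hence it starts \<open>q\<close>, and nothing of \<open>q\<close> precedes
    \<open>p\<close>.\<close>

  lemma once_prefixed_suffix_code:
    assumes "p \<in> once_prefixed x" "q \<in> once_prefixed x" "suffix p q"
    shows "p = q"
    using assms unfolding once_prefixed_def prefix_def suffix_def by auto

  text \<open>Complete return words are the leaves of the tree: an added letter leads out of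
    \<open>once_prefixed x\<close> exactly when it completes a second occurrence of
    \<open>x\<close>, which is then a suffix.\<close>

  lemma complete_return_word_iff:
    assumes "x \<noteq> []"
    shows "complete_return_word S x y \<longleftrightarrow>
      y \<in> S \<and> y \<notin> once_prefixed x \<and> (\<exists>p\<in>once_prefixed x. \<exists>b. y = p @ [b])"
  proof
    assume y: "complete_return_word S x y"
    then obtain u where u: "y = u @ x" "u \<noteq> []"
      unfolding complete_return_word_def strict_suffix_def suffix_def by auto
    have "y \<noteq> []" using u by simp
    then obtain p b where pb: "y = p @ [b]" by (metis rev_exhaust)
    have "p \<in> once_prefixed x"
      unfolding once_prefixed_def
    proof (intro CollectI conjI allI impI)
      show "p \<in> S" "prefix x p"
        using y pb prefix_closed[of p "[b]"] unfolding complete_return_word_def strict_prefix_def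
        by auto
      fix s t assume "p = s @ x @ t"
      then have "y = s @ x @ (t @ [b])" using pb by simp
      then show "s = []" using y unfolding complete_return_word_def internal_factor_def by blast
    qed
    moreover have "y \<notin> once_prefixed x"
      using u unfolding once_prefixed_def by (auto intro: exI[of _ u] exI[of _ "[]"])
    ultimately show "y \<in> S \<and> y \<notin> once_prefixed x \<and> (\<exists>p\<in>once_prefixed x. \<exists>b. y = p @ [b])"
      using y pb unfolding complete_return_word_def by blast
  next
    assume "y \<in> S \<and> y \<notin> once_prefixed x \<and> (\<exists>p\<in>once_prefixed x. \<exists>b. y = p @ [b])"
    then obtain p b where y: "y \<in> S" "y \<notin> once_prefixed x" "y = p @ [b]" and p: "p \<in> once_prefixed x"
      by blast
    \<comment> \<open>An occurrence ending before the last letter of \<open>y\<close> lies in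
      \<open>p\<close> and therefore starts it.\<close>
    have *: "v = []" if "y = u @ x @ v" "u \<noteq> []" for u v
    proof (cases v rule: rev_cases)
      case (snoc v' b')
      then have "p = u @ x @ v'" using that y(3) by auto
      then show ?thesis using p that(2) unfolding once_prefixed_def by blast
    qed simp
    have "prefix x y" using p y(3) unfolding once_prefixed_def by auto
    then obtain u v where "y = u @ x @ v" "u \<noteq> []"
      using y(1,2) unfolding once_prefixed_def by auto
    then have "strict_suffix x y"
      using * unfolding strict_suffix_def suffix_def by (metis append_Nil2 self_append_conv2)
    moreover have "strict_prefix x y"
      using p y(3) unfolding once_prefixed_def by (auto simp: strict_prefix_def prefix_def)
    moreover have "\<not> internal_factor x y"
      using * unfolding internal_factor_def by blast
    ultimately show "complete_return_word S x y"
      using y(1) unfolding complete_return_word_def by blast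
  qed

  text \<open>Along \<open>z\<close>, the first prefix outside \<open>once_prefixed x\<close> is a
    complete return word. That \<open>z'\<close> is nonempty makes \<open>p\<close> strictly shorter
    than this word.\<close>

  lemma once_prefixed_extend:
    assumes "x \<noteq> []" "p \<in> once_prefixed x" "p @ z \<in> S" "p @ z \<notin> once_prefixed x"
    shows "\<exists>z'. complete_return_word S x (p @ z') \<and> z' \<noteq> []"
    using assms(3,4)
  proof (induction z rule: rev_induct)
    case Nil
    then show ?case using assms(2) by simp
  next
    case (snoc b z)
    show ?case
    proof (cases "p @ z \<in> once_prefixed x")
      case True
      then have "complete_return_word S x (p @ z @ [b])"
        using snoc.prems complete_return_word_iff[OF assms(1), of "p @ z @ [b]"] by auto
      then show ?thesis by blast
    next
      case False
      then show ?thesis using snoc prefix_closed[of "p @ z" "[b]"] by simp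
    qed
  qed

  text \<open>The suffix starting at the last occurrence of \<open>x\<close> will do; the induction
    moves on to later occurrences.\<close>

  lemma once_prefixed_suffix_exists:
    assumes "u @ x @ v \<in> S"
    shows "\<exists>p\<in>once_prefixed x. suffix p (u @ x @ v)"
    using assms
  proof (induction v arbitrary: u rule: measure_induct_rule[of length])
    case (less v)
    have "x @ v \<in> S" using less.prems suffix_closed by blast
    show ?case
    proof (cases "x @ v \<in> once_prefixed x")
      case True
      then show ?thesis by (auto simp: suffix_def)
    next
      case False
      then obtain u' v' where uv: "x @ v = u' @ x @ v'" "u' \<noteq> []"
        using \<open>x @ v \<in> S\<close> unfolding once_prefixed_def by auto
      then have "length v' < length v" by (metis add_less_cancel_left length_append
        length_greater_0_conv less_add_same_cancel2 add.left_commute)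
      then show ?thesis
        using less.IH[of v' "u @ u'"] less.prems uv(1) by simp
    qed
  qed

  text \<open>Counts the nodes of each depth of the tree whose inner nodes are \<open>once_prefixed x\<close>.\<close>

  lemma card_return_level:
    assumes "x \<noteq> []" "x \<in> S" "length x \<le> n"
    shows "int (card {p \<in> once_prefixed x. length p = n}) +
        int (card {y. complete_return_word S x y \<and> length y \<le> n}) =
      1 + (\<Sum>p | p \<in> once_prefixed x \<and> length p < n. weight p)"
  proof -
    define P where "P n = {p \<in> once_prefixed x. length p = n}" for n
    define C where "C n = {y. complete_return_word S x y \<and> length y = n}" for n
    have "int (card (P n)) + int (card {y. complete_return_word S x y \<and> length y \<le> n}) =
      1 + (\<Sum>p | p \<in> once_prefixed x \<and> length p < n. weight p)"
    using assms(3)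
  proof (induction n rule: dec_induct)
    case base
    have "prefix x p" if "p \<in> once_prefixed x" for p
      using that unfolding once_prefixed_def by blast
    then have "p = x" if "p \<in> P (length x)" for p
      using that unfolding P_def prefix_def by fastforce
    then have P: "P (length x) = {x}"
      using once_prefixed_self[OF assms(2)] unfolding P_def by auto
    have "length x < length y" if "complete_return_word S x y" for y
      using that prefix_length_less unfolding complete_return_word_def by blast
    then have "{y. complete_return_word S x y \<and> length y \<le> length x} = {}" by force
    moreover have "{p. p \<in> once_prefixed x \<and> length p < length x} = {}"
      unfolding once_prefixed_def by (auto dest: prefix_length_le)
    ultimately show ?case using P by (simp only:) simp
  next
    case (step n)
    have finP: "finite (P m)" for m
      unfolding P_def once_prefixed_def using finite_length[of m]
      by (rule rev_finite_subset) auto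
    have finC: "finite (C m)" for m
      unfolding C_def complete_return_word_def using finite_length[of m]
      by (rule rev_finite_subset) auto
    have finC': "finite {y. complete_return_word S x y \<and> length y \<le> n}"
      by (rule finite_subset[of _ "\<Union>m\<le>n. C m"]) (use finC in \<open>auto simp: C_def\<close>)
    have finP': "finite {p. p \<in> once_prefixed x \<and> length p < n}"
      by (rule finite_subset[of _ "\<Union>m<n. P m"]) (use finP in \<open>auto simp: P_def\<close>)
    \<comment> \<open>Every node of depth \<open>Suc n\<close> is a child of an inner node of depth
      \<open>n\<close>, and is itself an inner node or a leaf.\<close>
    have children: "(\<lambda>(p, b). p @ [b]) ` Sigma (P n) (right_ext A S) = P (Suc n) \<union> C (Suc n)"
    proof (intro equalityI subsetI)
      fix y assume "y \<in> (\<lambda>(p, b). p @ [b]) ` Sigma (P n) (right_ext A S)"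
      then obtain p b where "y = p @ [b]" "p \<in> once_prefixed x" "length p = n" "p @ [b] \<in> S"
        unfolding P_def right_ext_def by auto
      then show "y \<in> P (Suc n) \<union> C (Suc n)"
        unfolding P_def C_def complete_return_word_iff[OF assms(1)] by auto
    next
      fix y assume y: "y \<in> P (Suc n) \<union> C (Suc n)"
      have "\<exists>p b. y = p @ [b] \<and> p \<in> once_prefixed x \<and> y \<in> S"
      proof (cases "y \<in> P (Suc n)")
        case False
        then show ?thesis using y unfolding C_def complete_return_word_iff[OF assms(1)] by auto
      next
        case True
        then obtain p b where pb: "y = p @ [b]" by (cases y rule: rev_cases) (auto simp: P_def)
        have yP: "y \<in> S" "prefix x y" "\<And>u v. y = u @ x @ v \<Longrightarrow> u = []" "length y = Suc n"
          using True unfolding P_def once_prefixed_def by auto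
        \<comment> \<open>\<open>y\<close> is longer than \<open>x\<close>, so the prefix
          \<open>x\<close> survives the loss of the last letter.\<close>
        have "y \<noteq> x" using yP(4) step.hyps by auto
        then have "prefix x p" using yP(2) pb by auto
        moreover have "p \<in> S" using yP(1) pb prefix_closed by blast
        moreover have "u = []" if "p = u @ x @ v" for u v
          using yP(3)[of u "v @ [b]"] that pb by simp
        ultimately show ?thesis using pb yP(1) unfolding once_prefixed_def by blast
      qed
      then obtain p b where pb: "y = p @ [b]" "p \<in> once_prefixed x" "y \<in> S" by blast
      have "length p = n" using y pb(1) unfolding P_def C_def by auto
      moreover have "b \<in> A" using in_lists[OF pb(3)] pb(1) by auto
      ultimately have "(p, b) \<in> Sigma (P n) (right_ext A S)"
        using pb unfolding P_def right_ext_def by auto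
      then show "y \<in> (\<lambda>(p, b). p @ [b]) ` Sigma (P n) (right_ext A S)"
        using pb(1) by force
    qed
    have "P (Suc n) \<inter> C (Suc n) = {}"
      unfolding P_def C_def complete_return_word_iff[OF assms(1)] by auto
    then have "card (P (Suc n)) + card (C (Suc n)) =
        card ((\<lambda>(p, b). p @ [b]) ` Sigma (P n) (right_ext A S))"
      unfolding children using finP finC by (simp add: card_Un_disjoint)
    also have "\<dots> = (\<Sum>p\<in>P n. card (right_ext A S p))"
      using finP finite_right_ext by (subst card_image) (auto simp: inj_on_def)
    \<comment> \<open>An inner node \<open>p\<close> has \<open>weight p + 1\<close>
      children.\<close>
    finally have 1: "int (card (P (Suc n))) + int (card (C (Suc n))) =
        int (card (P n)) + (\<Sum>p\<in>P n. weight p)"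
      unfolding weight_def by (simp add: sum_subtractf flip: of_nat_add)
    have "{y. complete_return_word S x y \<and> length y \<le> Suc n} =
        {y. complete_return_word S x y \<and> length y \<le> n} \<union> C (Suc n)"
      unfolding C_def by auto
    then have 2: "card {y. complete_return_word S x y \<and> length y \<le> Suc n} =
        card {y. complete_return_word S x y \<and> length y \<le> n} + card (C (Suc n))"
      using finC finC' by (subst card_Un_disjoint[symmetric]) (auto simp: C_def)
    have "{p. p \<in> once_prefixed x \<and> length p < Suc n} =
        {p. p \<in> once_prefixed x \<and> length p < n} \<union> P n"
      unfolding P_def by auto
    then have 3: "(\<Sum>p | p \<in> once_prefixed x \<and> length p < Suc n. weight p) =
        (\<Sum>p | p \<in> once_prefixed x \<and> length p < n. weight p) + (\<Sum>p\<in>P n. weight p)"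
      using finP finP' by (subst sum.union_disjoint[symmetric]) (auto simp: P_def)
    show ?case using 1 2 3 step.IH by simp
  qed
  then show ?thesis unfolding P_def .
qed

section \<open>Finiteness and number of complete return words\<close>

lemma finite_once_prefixed_less: "finite {p. p \<in> once_prefixed x \<and> length p < n}"
  by (rule finite_subset[of _ "\<Union>m<n. {w \<in> S. length w = m \<and> True}"])
    (use finite_length[of _ "\<lambda>_. True"] in \<open>auto simp: once_prefixed_def\<close>)

text \<open>Up to depth \<open>n\<close> the number of leaves is at most 1 plus the weight of a
  finite suffix code. The resulting bound is independent of \<open>n\<close>, so all finite sets of
  complete return words obey it.\<close>

lemma finite_complete_return_words:
  assumes "x \<noteq> []" "x \<in> S"
  shows "finite {y. complete_return_word S x y}"
proof -
  have "card F \<le> nat (1 + int (card A) - int c)"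
    if F: "F \<subseteq> {y. complete_return_word S x y}" "finite F" for F
  proof -
    obtain m where m: "\<And>y. y \<in> F \<Longrightarrow> length y \<le> m"
      using F(2) finite_nat_set_iff_bounded_le[of "length ` F"] by auto
    define n where "n = max m (length x)"
    let ?C = "{y. complete_return_word S x y \<and> length y \<le> n}"
    have "finite ?C"
      by (rule finite_subset[of _ "\<Union>m\<le>n. {w \<in> S. length w = m \<and> True}"])
        (use finite_length[of _ "\<lambda>_. True"] in \<open>auto simp: complete_return_word_def\<close>)
    moreover have "F \<subseteq> ?C" using F(1) m unfolding n_def by (auto simp: le_max_iff_disj)
    ultimately have "card F \<le> card ?C" by (rule card_mono)
    moreover have "int (card ?C) \<le> 1 + (\<Sum>p | p \<in> once_prefixed x \<and> length p < n. weight p)"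
      using card_return_level[OF assms, of n] unfolding n_def by simp
    moreover have "(\<Sum>p | p \<in> once_prefixed x \<and> length p < n. weight p) \<le> int (card A) - int c"
    proof (rule weight_suffix_code_le[OF finite_once_prefixed_less])
      show "{p. p \<in> once_prefixed x \<and> length p < n} \<subseteq> S"
        using once_prefixed_subset by blast
    qed (use assms Nil_notin_once_prefixed once_prefixed_suffix_code in blast)+
    ultimately show ?thesis by linarith
  qed
  then show ?thesis using finite_if_finite_subsets_card_bdd by blast
qed

lemma card_complete_return_words:
  assumes "x \<noteq> []" "x \<in> S" "recurrent_set A S"
  shows "int (card {y. complete_return_word S x y}) = 1 + int (card A) - int c"
proof -
  have rec: "\<exists>v. u @ v @ w \<in> S" if "u \<in> S" "w \<in> S" for u w
    using assms(3) that unfolding recurrent_set_def by blast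
  obtain m where m: "\<And>y. complete_return_word S x y \<Longrightarrow> length y \<le> m"
    using finite_complete_return_words[OF assms(1,2)]
      finite_nat_set_iff_bounded_le[of "length ` {y. complete_return_word S x y}"] by auto
  define n where "n = max m (length x)"
  \<comment> \<open>By recurrence \<open>x\<close> returns after \<open>p\<close>, so
    \<open>p\<close> is a proper prefix of a complete return word, and these have length at most
    \<open>m\<close>.\<close>
  have short: "length p < n" if p: "p \<in> once_prefixed x" for p
  proof -
    obtain v where v: "p @ v @ x \<in> S" using rec[of p x] p assms(2) unfolding once_prefixed_def by blast
    have "p \<noteq> []" using p Nil_notin_once_prefixed[OF assms(1)] by auto
    then have "p @ v @ x \<notin> once_prefixed x"
      unfolding once_prefixed_def by (auto intro: exI[of _ "p @ v"])
    then obtain z where "complete_return_word S x (p @ z)" "z \<noteq> []"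
      using once_prefixed_extend[OF assms(1) p v] by blast
    then show ?thesis using m[of "p @ z"] unfolding n_def by (cases z) auto
  qed
  \<comment> \<open>Unavoidability: some member of \<open>once_prefixed x\<close> is a suffix of
    \<open>x @ v @ w\<close> and, being shorter than \<open>w\<close>, of \<open>w\<close>
    itself.\<close>
  have "\<exists>p\<in>once_prefixed x. suffix p w" if w: "w \<in> S" "length w = n" for w
  proof -
    obtain v where "x @ v @ w \<in> S" using rec assms(2) w(1) by blast
    then obtain p where p: "p \<in> once_prefixed x" "suffix p (x @ v @ w)"
      using once_prefixed_suffix_exists[of "[]" x "v @ w"] by auto
    moreover have "suffix w (x @ v @ w)" by (auto simp: suffix_def)
    ultimately have "suffix p w"
      using short[of p] w(2) by (meson less_imp_le suffix_length_suffix)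
    then show ?thesis using p(1) by blast
  qed
  then have all: "{w. w \<in> S \<and> length w = n \<and> (\<exists>p\<in>once_prefixed x. suffix p w)} =
      {w. w \<in> S \<and> length w = n}"
    by blast
  have P: "{p. p \<in> once_prefixed x \<and> length p < n} = once_prefixed x" using short by blast
  have "(\<Sum>p\<in>once_prefixed x. weight p) = (\<Sum>w | w \<in> S \<and> length w = n. weight w)"
    unfolding all[symmetric]
  proof (rule weight_suffix_code)
    show "finite (once_prefixed x)" using finite_once_prefixed_less[of x n] P by simp
  qed (use once_prefixed_subset Nil_notin_once_prefixed[OF assms(1)] once_prefixed_suffix_code short
      less_imp_le in blast)+
  also have "\<dots> = int (card A) - int c"
    \<comment> \<open>\<open>weight_length\<close> is shifted by one; \<open>n\<close> is positive
      because \<open>x\<close> is nonempty.\<close>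
    using weight_length[of "n - 1"] assms(1,2) unfolding n_def by (cases x) auto
  finally have "(\<Sum>p\<in>once_prefixed x. weight p) = int (card A) - int c" .
  \<comment> \<open>At depth \<open>n\<close> no inner node is left and every leaf has been counted,
    so \<open>card_return_level\<close> yields the number of complete return words.\<close>
  moreover have "{p \<in> once_prefixed x. length p = n} = {}" using short by force
  moreover have "{y. complete_return_word S x y \<and> length y \<le> n} = {y. complete_return_word S x y}"
    using m unfolding n_def by (auto simp: le_max_iff_disj)
  moreover have "length x \<le> n" unfolding n_def by simp
  note card_return_level[OF assms(1,2) this, unfolded P]
  ultimately show ?thesis by (simp del: Collect_empty_eq)
qed

end

theorem theorem6p6:
  fixes A :: "'a set" and \<theta> :: "'a \<Rightarrow> 'a" and S :: "'a list set" and x :: "'a list"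
  assumes "finite A"
    and "involution_on A \<theta>"
    and "specular_set A \<theta> S"
    and "recurrent_set A S"
    and "x \<in> S"
    and "x \<noteq> []"
  shows "finite (right_return_words S x) \<and> card (right_return_words S x) = card A - 1"
proof -
  interpret neutral_set A S 2
    using assms(1,3) tree_set_imp_neutral_set unfolding specular_set_def by blast
  \<comment> \<open>Every complete return word starts with \<open>x\<close>, so prefixing
    \<open>x\<close> reaches all of them.\<close>
  have "(@) x ` right_return_words S x = {y. complete_return_word S x y}"
    unfolding right_return_words_def complete_return_word_def strict_prefix_def prefix_def by auto
  then have bij: "bij_betw ((@) x) (right_return_words S x) {y. complete_return_word S x y}"
    unfolding bij_betw_def by (simp add: inj_on_def)
  then have "finite (right_return_words S x)"
    using finite_complete_return_words assms(5,6) bij_betw_finite by blast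
  moreover have "card (right_return_words S x) = card A - 1"
    \<comment> \<open>The integer \<open>1 + card A - 2\<close> is a cardinality, hence nonnegative,
      and agrees with the truncated difference \<open>card A - 1\<close>.\<close>
    using bij_betw_same_card[OF bij] card_complete_return_words[OF assms(6,5,4)] by simp
  ultimately show ?thesis ..
qed

end
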